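(* Let $k\ge 1$ and $s\ge 0$ be integers and let $D_{k,s}(x)=\sum_{n\ge s+k}\frac{p_{n;\le n-s;k}}{n!}x^n$. Then, as formal power series, $$D_{k,s}(x)=[P(x)]^{k+1}\sum_{i=0}^{k+s}\frac{(-1)^i(k+s+1-i)^i}{i!}x^i-[P(x)]^{k}\sum_{i=0}^{k+s-1}\frac{(-1)^i(k+s-i)^i}{i!}x^i.$$
   Context: Parking model: there are $n$ parking spaces in a line, numbered $1,\dots,n$. A preference set of length $n$ is a sequence $(a_1,\dots,a_n)$ of integers with $1\le a_i\le n$; cars $1,\dots,n$ arrive in order, car $i$ parks in the first unoccupied space numbered $\ge a_i$ if one exists, otherwise it fails to park. It is $k$-flaw if exactly $k$ cars fail to park. $p_{n;\le t;k}$ denotes the number of $k$-flaw preference sets of length $n$ with $n$ spaces and all entries $\le t$. $P(x)=\sum_{n\ge 0}\frac{(n+1)^{n-1}}{n!}x^n$. *)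

theory Defs
  imports Complex_Main "HOL-Computational_Algebra.Formal_Power_Series"
begin

text \<open>\<open>flaws n occ as\<close> runs the parking process on the spaces \<open>1, \<dots>, n\<close>, of which those in
  \<open>occ\<close> are already taken, and returns the number of cars in \<open>as\<close> that fail to park.\<close>

fun flaws :: "nat \<Rightarrow> nat set \<Rightarrow> nat list \<Rightarrow> nat" where
  "flaws n occ [] = 0"
| "flaws n occ (a # as) =
     (if \<exists>j. a \<le> j \<and> j \<le> n \<and> j \<notin> occ
      then flaws n (insert (LEAST j. a \<le> j \<and> j \<le> n \<and> j \<notin> occ) occ) as
      else Suc (flaws n occ as))"

definition preference_sets :: "nat \<Rightarrow> nat list set" where
  "preference_sets n = {as. length as = n \<and> (\<forall>a\<in>set as. 1 \<le> a \<and> a \<le> n)}"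

definition flaw_count :: "nat \<Rightarrow> nat \<Rightarrow> nat \<Rightarrow> nat" where
  "flaw_count n t k =
     card {as \<in> preference_sets n. (\<forall>a\<in>set as. a \<le> t) \<and> flaws n {} as = k}"

text \<open>At \<open>n = 0\<close> the exponent \<open>n - 1\<close> truncates, which is harmless as the base is then 1.\<close>

definition parking_fps :: "rat fps" where
  "parking_fps = Abs_fps (\<lambda>n. of_nat ((n + 1) ^ (n - 1)) / fact n)"

definition flaw_fps :: "nat \<Rightarrow> nat \<Rightarrow> rat fps" where
  "flaw_fps k s =
     Abs_fps (\<lambda>n. if s + k \<le> n then of_nat (flaw_count n (n - s) k) / fact n else 0)"

end

theory Submission
  imports Defs
begin

text \<open>A list of \<open>n\<close> preferences has at most \<open>k\<close> flaws iff for every \<open>j\<close> at least \<open>j - k\<close> of them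
  are \<open>\<le> j\<close>. Removing the cars that prefer the largest allowed space \<open>t\<close> gives a recursion in \<open>t\<close>
  for the number of such lists with entries \<open>\<le> t\<close>, and the binomial theorem shows that the
  alternating sum in the theorem satisfies the same recursion; the initial value \<open>t = 0\<close> is an
  instance of Abel's binomial identity. Abel's identity and the coefficients of the powers of \<open>P\<close>
  come from \<open>P = exp T\<close>, where \<open>T = x exp T\<close>. Subtracting the series for \<open>k - 1\<close> from the series
  for \<open>k\<close> gives the theorem; for \<open>n < s\<close>, Abel's identity shows that both have the same
  coefficient \<open>(n - s)\<^sup>n / n!\<close>.\<close>

unbundle fps_syntax

section \<open>Powers of the parking series and Abel's identity\<close>

text \<open>This is the exponential generating function T of rooted labelled trees, encoded as the
  compositional inverse of x exp(-x).\<close>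

definition tree_fps :: "rat fps" where
  "tree_fps = fps_inv (fps_X * fps_exp (-1))"

definition exp_tree :: "rat \<Rightarrow> rat fps" where
  "exp_tree c = fps_exp c oo tree_fps"

text \<open>Dividing by 1 - T turns the coefficients c (c+n)^(n-1) / n! of exp(cT) into the plain
  powers (c+n)^n / n!.\<close>

definition exp_tree_quot :: "rat \<Rightarrow> rat fps" where
  "exp_tree_quot c = exp_tree c * inverse (1 - tree_fps)"

lemma tree_fps_nth_0 [simp]: "tree_fps $ 0 = 0"
  by (simp add: tree_fps_def fps_inv_def)

lemma exp_tree_add: "exp_tree (c + d) = exp_tree c * exp_tree d"
  by (simp add: exp_tree_def fps_exp_add_mult fps_compose_mult_distrib)

lemma exp_tree_0 [simp]: "exp_tree 0 = 1"
  by (simp add: exp_tree_def)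

lemma exp_tree_nth_0 [simp]: "exp_tree c $ 0 = 1"
  by (simp add: exp_tree_def)

lemma exp_tree_power: "exp_tree c ^ m = exp_tree (of_nat m * c)"
  by (induction m) (simp_all add: exp_tree_add algebra_simps)

lemma tree_fps_eq: "tree_fps = fps_X * exp_tree 1"
proof -
  have "(fps_X * fps_exp (-1)) oo tree_fps = fps_X"
    unfolding tree_fps_def by (rule fps_inv_right) simp_all
  then have "tree_fps * exp_tree (-1) = fps_X"
    by (simp add: fps_compose_mult_distrib exp_tree_def)
  then have "fps_X * exp_tree 1 = tree_fps * (exp_tree (-1) * exp_tree 1)"
    by (simp add: mult.assoc)
  then show ?thesis
    by (simp flip: exp_tree_add)
qed

lemma one_minus_tree_fps_inverse: "(1 - tree_fps) * inverse (1 - tree_fps) = 1"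
  by (rule inverse_mult_eq_1') simp

text \<open>Since x exp(T) = T, the last summand is T exp(cT) / (1 - T), and 1/(1 - T) = 1 + T/(1 -
  T).\<close>

lemma exp_tree_quot_rec: "exp_tree_quot c = exp_tree c + fps_X * exp_tree_quot (c + 1)"
proof -
  have "fps_X * exp_tree_quot (c + 1) = tree_fps * exp_tree_quot c"
    by (subst tree_fps_eq) (simp add: exp_tree_quot_def exp_tree_add algebra_simps)
  moreover have "(1 - tree_fps) * exp_tree_quot c = exp_tree c"
    using one_minus_tree_fps_inverse by (simp add: exp_tree_quot_def mult.left_commute)
  ultimately show ?thesis
    by (simp add: algebra_simps)
qed

text \<open>Differentiating T = x exp(T) gives T' = exp(T) + T T', so T' = exp(T) / (1 - T); the
  rest is the chain rule.\<close>

lemma deriv_exp_tree: "fps_deriv (exp_tree c) = fps_const c * exp_tree_quot (c + 1)"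
proof -
  have deriv: "fps_deriv (exp_tree d) = fps_const d * exp_tree d * fps_deriv tree_fps" for d
    by (simp add: exp_tree_def fps_compose_deriv fps_compose_mult_distrib)
  have "fps_deriv tree_fps = fps_deriv (fps_X * exp_tree 1)"
    by (simp flip: tree_fps_eq)
  also have "\<dots> = exp_tree 1 + (fps_X * exp_tree 1) * fps_deriv tree_fps"
    by (simp add: deriv algebra_simps)
  also have "\<dots> = exp_tree 1 + tree_fps * fps_deriv tree_fps"
    by (simp flip: tree_fps_eq)
  finally have "fps_deriv tree_fps * (1 - tree_fps) = exp_tree 1"
    by (simp add: algebra_simps)
  then have "fps_deriv tree_fps * ((1 - tree_fps) * inverse (1 - tree_fps)) = exp_tree_quot 1"
    by (simp add: exp_tree_quot_def flip: mult.assoc)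
  then have "fps_deriv tree_fps = exp_tree_quot 1"
    by (simp add: one_minus_tree_fps_inverse)
  then show ?thesis
    by (simp add: deriv exp_tree_quot_def exp_tree_add mult.assoc)
qed

lemma exp_tree_nth_Suc: "exp_tree c $ Suc n = c * exp_tree_quot (c + 1) $ n / of_nat (Suc n)"
proof -
  have "of_nat (Suc n) * exp_tree c $ Suc n = c * exp_tree_quot (c + 1) $ n"
    using arg_cong[OF deriv_exp_tree, of "\<lambda>f. f $ n" c] by simp
  then show ?thesis
    by (simp add: field_simps del: of_nat_Suc)
qed

text \<open>The recursion and the derivative both lead from index n+1 at c to index n at c+1, so
  induction with c arbitrary replaces Lagrange inversion. The factor that appears is 1 +
  c/(n+1).\<close>

lemma exp_tree_quot_nth: "exp_tree_quot c $ n = (c + of_nat n) ^ n / fact n"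
proof (induction n arbitrary: c)
  case 0
  then show ?case by (simp add: exp_tree_quot_def)
next
  case (Suc n)
  have "exp_tree_quot c $ Suc n = exp_tree c $ Suc n + exp_tree_quot (c + 1) $ n"
    by (subst exp_tree_quot_rec) simp
  also have "\<dots> = (c + of_nat (Suc n)) / of_nat (Suc n) * exp_tree_quot (c + 1) $ n"
    by (simp add: exp_tree_nth_Suc field_simps del: of_nat_Suc)
  also have "\<dots> = (c + of_nat (Suc n)) ^ Suc n / fact (Suc n)"
    by (simp add: Suc.IH add_ac)
  finally show ?case .
qed

lemma parking_fps_eq: "parking_fps = exp_tree 1"
proof (rule fps_ext)
  show "parking_fps $ n = exp_tree 1 $ n" for n
    by (cases n) (simp_all add: parking_fps_def exp_tree_nth_Suc exp_tree_quot_nth add_ac)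
qed

lemma parking_fps_power: "parking_fps ^ m = exp_tree (of_nat m)"
  by (simp add: parking_fps_eq exp_tree_power)

text \<open>Compare coefficients in exp((a+b)T) / (1-T) = exp(bT) / (1-T) times exp(aT). For m > 0,
  \<open>fact m * exp_tree a $ m\<close> is a (a+m)^(m-1); keeping it as a coefficient also covers m
  = 0 and a = 0.\<close>

lemma abel_identity:
  "(\<Sum>i\<le>n. of_nat (n choose i) * (b + of_nat i) ^ i * (fact (n - i) * exp_tree a $ (n - i)))
     = (a + b + of_nat n) ^ n"
proof -
  have "exp_tree_quot (a + b) = exp_tree_quot b * exp_tree a"
    by (simp add: exp_tree_quot_def exp_tree_add algebra_simps)
  then have "(a + b + of_nat n) ^ n / fact n
      = (\<Sum>i\<le>n. (b + of_nat i) ^ i / fact i * exp_tree a $ (n - i))"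
    by (simp add: fps_mult_nth exp_tree_quot_nth atLeast0AtMost flip: exp_tree_quot_nth[of "a + b"])
  then have "(a + b + of_nat n) ^ n
      = (\<Sum>i\<le>n. fact n * ((b + of_nat i) ^ i / fact i * exp_tree a $ (n - i)))"
    by (simp add: field_simps sum_distrib_left)
  also have "\<dots> = (\<Sum>i\<le>n. of_nat (n choose i) * (b + of_nat i) ^ i
      * (fact (n - i) * exp_tree a $ (n - i)))"
    by (intro sum.cong refl) (simp add: binomial_fact field_simps)
  finally show ?thesis by simp
qed

section \<open>The alternating sum\<close>

text \<open>For q m = m! f_m this is n! times the coefficient of x^n in f times a polynomial of
  degree d of the kind in the theorem. Terms with i > n vanish through the binomial coefficient, so
  the truncation in \<open>n - i\<close> is harmless.\<close>

definition alt_sum :: "(nat \<Rightarrow> rat) \<Rightarrow> nat \<Rightarrow> nat \<Rightarrow> rat" where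
  "alt_sum q d n =
     (\<Sum>i\<le>d. of_nat (n choose i) * (-1) ^ i * of_nat (d + 1 - i) ^ i * q (n - i))"

text \<open>For l > n both sides are 0; this lets the sums in \<open>alt_sum_rec\<close> run to d +
  1 whatever n is.\<close>

lemma choose_mult_diff:
  assumes "j \<le> l"
  shows "(n choose j) * ((n - j) choose (l - j)) = (n choose l) * (l choose j)"
proof (cases "l \<le> n")
  case True
  then show ?thesis using assms by (simp add: choose_mult)
next
  case False
  then show ?thesis using assms by (cases "j \<le> n") (simp_all add: binomial_eq_0)
qed

text \<open>Collect the terms with i + j = l, which share the base d + 2 - l. By the binomial
  theorem the sum over j is (1 - (d + 2 - l))^l, which lowers the base to d + 1 - l.\<close>

lemma alt_sum_rec:
  "(\<Sum>j\<le>d+1. of_nat (n choose j) * alt_sum q (d + 1 - j) (n - j)) = alt_sum q d n"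
proof -
  let ?g = "\<lambda>j i. of_nat (n choose j) * (of_nat ((n - j) choose i) * (-1) ^ i
    * of_nat (d + 2 - (j + i)) ^ i * q (n - (j + i)))"
  let ?c = "\<lambda>l. of_nat (d + 2 - l) :: rat"
  have "(\<Sum>j\<le>d+1. of_nat (n choose j) * alt_sum q (d + 1 - j) (n - j))
      = (\<Sum>j\<le>d+1. \<Sum>i\<le>d + 1 - j. ?g j i)"
    unfolding alt_sum_def sum_distrib_left
    by (intro sum.cong refl) (simp add: diff_diff_add Suc_diff_le)
  also have "\<dots> = (\<Sum>(j, i)\<in>{(j, i). j + i \<le> d + 1}. ?g j i)"
    by (subst sum.Sigma) (auto intro!: sum.cong)
  also have "\<dots> = (\<Sum>l\<le>d+1. \<Sum>j\<le>l. ?g j (l - j))"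
    by (rule sum.triangle_reindex_eq)
  also have "\<dots> = (\<Sum>l\<le>d+1. of_nat (n choose l) * (-1) ^ l * of_nat (d + 1 - l) ^ l * q (n - l))"
  proof (intro sum.cong refl)
    fix l assume l: "l \<in> {..d+1}"
    have "(\<Sum>j\<le>l. ?g j (l - j))
        = (\<Sum>j\<le>l. of_nat (n choose l) * q (n - l) * (of_nat (l choose j) * 1 ^ j * (- ?c l) ^ (l - j)))"
    proof (intro sum.cong refl)
      fix j assume "j \<in> {..l}"
      then have j: "j \<le> l" by simp
      have "?g j (l - j) = of_nat ((n choose j) * ((n - j) choose (l - j)))
          * q (n - l) * ((-1) ^ (l - j) * ?c l ^ (l - j))"
        using j by (simp add: mult_ac)
      also have "\<dots> = of_nat ((n choose l) * (l choose j)) * q (n - l) * (- ?c l) ^ (l - j)"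
        by (simp only: choose_mult_diff[OF j] power_mult_distrib[symmetric] mult_minus1)
      finally show "?g j (l - j)
          = of_nat (n choose l) * q (n - l) * (of_nat (l choose j) * 1 ^ j * (- ?c l) ^ (l - j))"
        by simp
    qed
    also have "\<dots> = of_nat (n choose l) * q (n - l) * (1 - ?c l) ^ l"
      using binomial_ring[of 1 "- ?c l" l] by (simp add: sum_distrib_left)
    also have "1 - ?c l = - of_nat (d + 1 - l)"
      using l by (simp add: of_nat_diff)
    also have "(- of_nat (d + 1 - l) :: rat) ^ l = (-1) ^ l * of_nat (d + 1 - l) ^ l"
      by (rule power_minus)
    finally show "(\<Sum>j\<le>l. ?g j (l - j))
        = of_nat (n choose l) * (-1) ^ l * of_nat (d + 1 - l) ^ l * q (n - l)"
      by (simp add: mult_ac)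
  qed
  \<comment> \<open>The term l = d + 1 has base 0 and a positive exponent, so the sum ends at
    d.\<close>
  also have "\<dots> = alt_sum q d n"
    by (simp add: alt_sum_def)
  finally show ?thesis .
qed

text \<open>This is Abel's identity at b = -d - 1, available once the sum reaches every i up to
  n.\<close>

lemma alt_sum_exp_tree:
  assumes "n \<le> d + 1"
  shows "alt_sum (\<lambda>m. fact m * exp_tree a $ m) d n = (a + of_nat n - of_nat d - 1) ^ n"
proof -
  let ?f = "\<lambda>i. of_nat (n choose i) * (-1) ^ i * of_nat (d + 1 - i) ^ i
    * (fact (n - i) * exp_tree a $ (n - i)) :: rat"
  \<comment> \<open>The added term i = d + 1 is 0; including it admits the case n = d + 1.\<close>
  have "alt_sum (\<lambda>m. fact m * exp_tree a $ m) d n = sum ?f {..d+1}"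
    by (simp add: alt_sum_def)
  also have "\<dots> = sum ?f {..n}"
    using assms by (intro sum.mono_neutral_right) auto
  also have "\<dots> = (\<Sum>i\<le>n. of_nat (n choose i) * (- of_nat d - 1 + of_nat i) ^ i
      * (fact (n - i) * exp_tree a $ (n - i)))"
  proof (intro sum.cong refl)
    fix i assume "i \<in> {..n}"
    then have "- of_nat d - 1 + of_nat i = (-1) * (of_nat (d + 1 - i) :: rat)"
      using assms by (simp add: of_nat_diff)
    then show "?f i = of_nat (n choose i) * (- of_nat d - 1 + of_nat i) ^ i
        * (fact (n - i) * exp_tree a $ (n - i))"
      by (simp only: power_mult_distrib mult.assoc)
  qed
  also have "\<dots> = (a + of_nat n - of_nat d - 1) ^ n"
    by (subst abel_identity) (simp add: algebra_simps)
  finally show ?thesis .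
qed

lemma fps_nth_mult_alternating_polynomial:
  "(f * (\<Sum>i=0..d. fps_const ((-1) ^ i * of_nat ((d + 1 - i) ^ i) / fact i) * fps_X ^ i)) $ n
     = alt_sum (\<lambda>m. fact m * f $ m) d n / fact n"
proof -
  have "(f * (\<Sum>i=0..d. fps_const ((-1) ^ i * of_nat ((d + 1 - i) ^ i) / fact i) * fps_X ^ i)) $ n
      = (\<Sum>i\<le>d. (-1) ^ i * of_nat ((d + 1 - i) ^ i) / fact i * (if n < i then 0 else f $ (n - i)))"
    unfolding sum_distrib_left fps_sum_nth atLeast0AtMost
    by (intro sum.cong refl)
      (simp add: fps_X_power_mult_right_nth mult.left_commute[of f] flip: mult.assoc)
  also have "\<dots> = alt_sum (\<lambda>m. fact m * f $ m) d n / fact n"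
    unfolding alt_sum_def sum_divide_distrib
    by (intro sum.cong refl) (auto simp: binomial_fact field_simps)
  finally show ?thesis .
qed

section \<open>Counting preference lists with at most k flaws\<close>

text \<open>A Hall-type condition: cars preferring a space beyond j can only park beyond j, and the
  worst j accounts for all failures. In the induction a failing car uses up one unit of k and a
  parking car one free space, hence the general \<open>occ\<close> and \<open>k\<close>.\<close>

lemma flaws_le_iff:
  assumes "\<forall>a\<in>set as. 1 \<le> a \<and> a \<le> n"
  shows "flaws n occ as \<le> k \<longleftrightarrow>
    (\<forall>j\<le>n. length (filter (\<lambda>a. j < a) as) \<le> k + card ({j<..n} - occ))"
  using assms
proof (induction as arbitrary: occ k)
  case Nil
  then show ?case by simp
next
  case (Cons a as)
  let ?N = "\<lambda>j. length (filter (\<lambda>a. j < a) as)"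
  let ?free = "\<lambda>j. card ({j<..n} - occ)"
  have a: "1 \<le> a" "a \<le> n" and as: "\<forall>a\<in>set as. 1 \<le> a \<and> a \<le> n"
    using Cons.prems by auto
  have N_mono: "?N j \<le> ?N (a - 1)" if "a \<le> j" for j
    using that a by (induction as) auto
  have lhs: "length (filter (\<lambda>b. j < b) (a # as)) = (if j < a then 1 else 0) + ?N j" for j
    by simp
  show ?case
  proof (cases "\<exists>j. a \<le> j \<and> j \<le> n \<and> j \<notin> occ")
    case False
    have free0: "?free j = 0" if "a - 1 \<le> j" for j
      using False that a by (auto simp: card_eq_0_iff)
    have "flaws n occ (a # as) \<le> k \<longleftrightarrow> 1 \<le> k \<and> flaws n occ as \<le> k - 1"
      using False by auto
    also have "\<dots> \<longleftrightarrow> 1 \<le> k \<and> (\<forall>j\<le>n. ?N j \<le> k - 1 + ?free j)"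
      by (simp add: Cons.IH[OF as])
    also have "\<dots> \<longleftrightarrow> (\<forall>j\<le>n. (if j < a then 1 else 0) + ?N j \<le> k + ?free j)" (is "?A \<longleftrightarrow> ?B")
    proof
      assume ?A
      then show ?B by fastforce
    next
      assume B: ?B
      \<comment> \<open>No space from a on is free, so the instance j = a - 1, which counts the
        failing car, yields both 1 <= k and, by \<open>N_mono\<close>, the bounds for all j >=
        a.\<close>
      have top: "1 + ?N (a - 1) \<le> k"
        using B[rule_format, of "a - 1"] a unfolding free0[OF order_refl] by simp
      show ?A
      proof (intro conjI allI impI)
        show "1 \<le> k" using top by simp
        fix j assume "j \<le> n"
        then show "?N j \<le> k - 1 + ?free j"
          using B[rule_format, of j] top N_mono[of j] by (cases "j < a") auto
      qed
    qed
    finally show ?thesis by (simp only: lhs)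
  next
    case True
    define p where "p = (LEAST j. a \<le> j \<and> j \<le> n \<and> j \<notin> occ)"
    have p: "a \<le> p" "p \<le> n" "p \<notin> occ"
      using LeastI_ex[OF True] by (auto simp: p_def)
    have below: "j \<in> occ" if "a \<le> j" "j < p" for j
      using not_less_Least[of j "\<lambda>j. a \<le> j \<and> j \<le> n \<and> j \<notin> occ"] that p by (auto simp: p_def)
    have free_insert: "?free j = card ({j<..n} - insert p occ) + (if j < p then 1 else 0)" for j
    proof (cases "j < p")
      case True
      then have "?free j = card (insert p ({j<..n} - insert p occ))"
        using p by (intro arg_cong[of _ _ card]) auto
      also have "\<dots> = card ({j<..n} - insert p occ) + 1"
        by (subst card_insert_disjoint) auto
      finally show ?thesis using True by simp
    next
      case False
      then have "{j<..n} - occ = {j<..n} - insert p occ" by auto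
      then show ?thesis using False by simp
    qed
    \<comment> \<open>The spaces from a to p - 1 are taken. Hence the instance j = a - 1 implies
      those for a <= j < p, and the indicator of j < p produced by parking at p can be exchanged for
      that of j < a.\<close>
    have free_eq: "?free j = ?free (a - 1)" if "a \<le> j" "j < p" for j
    proof -
      have "j < x \<longleftrightarrow> a - 1 < x" if "x \<notin> occ" for x
        using below[of x] that \<open>a \<le> j\<close> \<open>j < p\<close> a by linarith
      then have "{j<..n} - occ = {a - 1<..n} - occ"
        by auto
      then show ?thesis by simp
    qed
    have "flaws n occ (a # as) \<le> k \<longleftrightarrow> (\<forall>j\<le>n. ?N j \<le> k + card ({j<..n} - insert p occ))"
      using True Cons.IH[OF as, of "insert p occ"] by (simp add: p_def)
    also have "\<dots> \<longleftrightarrow> (\<forall>j\<le>n. (if j < p then 1 else 0) + ?N j \<le> k + ?free j)"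
      by (simp add: free_insert)
    also have "\<dots> \<longleftrightarrow> (\<forall>j\<le>n. (if j < a then 1 else 0) + ?N j \<le> k + ?free j)" (is "?A \<longleftrightarrow> ?B")
    proof
      assume ?A
      then show ?B using p(1) by (auto split: if_splits)
    next
      assume B: ?B
      show ?A
      proof (intro allI impI)
        fix j assume j: "j \<le> n"
        show "(if j < p then 1 else 0) + ?N j \<le> k + ?free j"
        proof (cases "a \<le> j \<and> j < p")
          case True
          have "1 + ?N (a - 1) \<le> k + ?free (a - 1)"
            using B[rule_format, of "a - 1"] a by simp
          then show ?thesis using True N_mono[of j] free_eq[of j] by simp
        next
          case False
          then show ?thesis using B[rule_format, OF j] p(1) by (auto split: if_splits)
        qed
      qed
    qed
    finally show ?thesis by (simp only: lhs)
  qed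
qed

text \<open>No relation between t and n is imposed, because the recursion in t reaches lists shorter
  than t, where the link to \<open>flaws\<close> is lost.\<close>

definition few_flaw_lists :: "nat \<Rightarrow> nat \<Rightarrow> nat \<Rightarrow> nat list set" where
  "few_flaw_lists k t n = {as. length as = n \<and> set as \<subseteq> {1..t} \<and>
     (\<forall>j\<le>t. j \<le> k + length (filter (\<lambda>a. a \<le> j) as))}"

lemma flaws_le_iff_few_flaw_lists:
  assumes "length as = n" "set as \<subseteq> {1..t}" "t \<le> n"
  shows "flaws n {} as \<le> k \<longleftrightarrow> as \<in> few_flaw_lists k t n"
proof -
  have len: "length (filter (\<lambda>a. j < a) as) + length (filter (\<lambda>a. a \<le> j) as) = n" for j
    using sum_length_filter_compl[of "\<lambda>a. j < a" as] assms(1) by (simp add: not_less)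
  have all: "filter (\<lambda>a. a \<le> j) as = as" if "t \<le> j" for j
    using assms(2) that by (intro filter_True) auto
  have "flaws n {} as \<le> k \<longleftrightarrow> (\<forall>j\<le>n. length (filter (\<lambda>a. j < a) as) \<le> k + (n - j))"
    using assms(2,3) by (subst flaws_le_iff) auto
  also have "\<dots> \<longleftrightarrow> (\<forall>j\<le>n. j \<le> k + length (filter (\<lambda>a. a \<le> j) as))"
  proof (intro all_cong1 imp_cong refl)
    fix j assume "j \<le> n"
    then show "length (filter (\<lambda>a. j < a) as) \<le> k + (n - j)
        \<longleftrightarrow> j \<le> k + length (filter (\<lambda>a. a \<le> j) as)"
      using len[of j] by linarith
  qed
  \<comment> \<open>For t <= j <= n all n entries are at most j, so the condition holds by
    itself.\<close>
  also have "\<dots> \<longleftrightarrow> (\<forall>j\<le>t. j \<le> k + length (filter (\<lambda>a. a \<le> j) as))"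
    using assms(1,3) all by (metis le_trans nat_le_linear trans_le_add2)
  finally show ?thesis
    using assms(1,2) by (simp add: few_flaw_lists_def)
qed

lemma finite_few_flaw_lists [simp]: "finite (few_flaw_lists k t n)"
  by (rule finite_subset[OF _ finite_lists_length_eq[of "{1..t}" n]])
    (auto simp: few_flaw_lists_def)

lemma few_flaw_lists_eq_empty:
  assumes "k + n < t"
  shows "few_flaw_lists k t n = {}"
proof -
  have "t \<le> k + n" if "as \<in> few_flaw_lists k t n" for as
  proof -
    have "t \<le> k + length (filter (\<lambda>a. a \<le> t) as)" "length as = n"
      using that by (simp_all add: few_flaw_lists_def)
    then show ?thesis
      using length_filter_le[of "\<lambda>a. a \<le> t" as] by linarith
  qed
  then show ?thesis using assms by fastforce
qed

text \<open>Entries equal to t + 1 do not affect the conditions with j <= t, and the condition at j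
  = t + 1 is just the assumption. They may therefore be inserted anywhere.\<close>

lemma few_flaw_lists_Suc:
  assumes "Suc t \<le> k + n"
  shows "few_flaw_lists k (Suc t) n
    = (\<Union>m\<in>{..n}. \<Union>bs\<in>few_flaw_lists k t m. shuffles (replicate (n - m) (Suc t)) bs)"
    (is "_ = ?U")
proof (intro equalityI subsetI)
  fix as assume as: "as \<in> few_flaw_lists k (Suc t) n"
  define bs where "bs = filter (\<lambda>a. a \<noteq> Suc t) as"
  have "filter (\<lambda>a. a \<le> j) bs = filter (\<lambda>a. a \<le> j) as" if "j \<le> t" for j
    using that by (auto simp: bs_def intro!: filter_cong)
  moreover have "set bs \<subseteq> {1..t}"
    using as by (force simp: bs_def few_flaw_lists_def)
  ultimately have bs: "bs \<in> few_flaw_lists k t (length bs)"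
    using as by (auto simp: few_flaw_lists_def)
  have "length (filter (\<lambda>a. a = Suc t) as) + length bs = n"
    using sum_length_filter_compl[of "\<lambda>a. a = Suc t" as] as
    by (simp add: bs_def few_flaw_lists_def)
  moreover have "filter (\<lambda>a. a = Suc t) as
      = replicate (length (filter (\<lambda>a. a = Suc t) as)) (Suc t)"
    by (induction as) auto
  ultimately have "length bs \<le> n"
    and "filter (\<lambda>a. a = Suc t) as = replicate (n - length bs) (Suc t)"
    by (auto simp flip: \<open>_ + length bs = n\<close>)
  moreover have "as \<in> shuffles (filter (\<lambda>a. a = Suc t) as) bs"
    using partition_in_shuffles[of as "\<lambda>a. a = Suc t"] by (simp add: bs_def)
  ultimately show "as \<in> ?U"
    using bs by auto
next
  fix as assume "as \<in> ?U"
  then obtain m bs where m: "m \<le> n" and bs: "bs \<in> few_flaw_lists k t m"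
    and as: "as \<in> shuffles (replicate (n - m) (Suc t)) bs" by auto
  have len: "length as = n"
    using length_shuffles[OF as] m bs by (simp add: few_flaw_lists_def)
  have set: "set as \<subseteq> {1..Suc t}"
    using set_shuffles[OF as] bs by (force simp: few_flaw_lists_def)
  have "j \<le> k + length (filter (\<lambda>a. a \<le> j) as)" if "j \<le> Suc t" for j
  proof (cases "j = Suc t")
    case True
    then have "filter (\<lambda>a. a \<le> j) as = as"
      using set by (intro filter_True) auto
    then show ?thesis using True len assms by simp
  next
    case False
    then have j: "j \<le> t" using that by simp
    have "filter (\<lambda>a. a \<le> j) as \<in> filter (\<lambda>a. a \<le> j) ` shuffles (replicate (n - m) (Suc t)) bs"
      using as by blast
    also have "\<dots> = {filter (\<lambda>a. a \<le> j) bs}"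
      using j by (subst filter_shuffles) (simp add: filter_replicate)
    finally show ?thesis using bs j by (simp add: few_flaw_lists_def)
  qed
  then show "as \<in> few_flaw_lists k (Suc t) n"
    using len set by (simp add: few_flaw_lists_def)
qed

text \<open>Deleting the entries t + 1 recovers \<open>bs\<close>, and m is its length, so the
  shuffles are pairwise disjoint. The index j = n - m is the number of entries equal to t +
  1.\<close>

lemma card_few_flaw_lists_Suc:
  assumes "Suc t \<le> k + n"
  shows "card (few_flaw_lists k (Suc t) n)
    = (\<Sum>j\<le>n. (n choose j) * card (few_flaw_lists k t (n - j)))"
proof -
  let ?S = "\<lambda>m bs. shuffles (replicate (n - m) (Suc t)) bs"
  have notin: "Suc t \<notin> set bs" if "bs \<in> few_flaw_lists k t m" for bs m
    using that by (auto simp: few_flaw_lists_def)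
  have recover: "filter (\<lambda>a. a \<noteq> Suc t) as = bs"
    if "bs \<in> few_flaw_lists k t m" "as \<in> ?S m bs" for as bs m
  proof -
    have "filter (\<lambda>a. a \<noteq> Suc t) as \<in> filter (\<lambda>a. a \<noteq> Suc t) ` ?S m bs"
      using that by blast
    also have "\<dots> = {bs}"
      using notin[OF that(1)]
      by (subst filter_shuffles) (auto simp: filter_replicate intro!: filter_True)
    finally show ?thesis by simp
  qed
  have len: "length bs = m" if "bs \<in> few_flaw_lists k t m" for bs m
    using that by (simp add: few_flaw_lists_def)
  have same: "m = m'" if "bs \<in> few_flaw_lists k t m" "as \<in> ?S m bs"
    "bs' \<in> few_flaw_lists k t m'" "as \<in> ?S m' bs'" for as bs bs' m m'
    using recover[OF that(1,2)] recover[OF that(3,4)] len[OF that(1)] len[OF that(3)] by simp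
  have "card (few_flaw_lists k (Suc t) n)
      = (\<Sum>m\<le>n. card (\<Union>bs\<in>few_flaw_lists k t m. ?S m bs))"
    unfolding few_flaw_lists_Suc[OF assms]
    by (rule card_UN_disjoint) (auto dest: same)
  also have "\<dots> = (\<Sum>m\<le>n. \<Sum>bs\<in>few_flaw_lists k t m. card (?S m bs))"
    by (intro sum.cong refl card_UN_disjoint) (auto dest: recover)
  also have "\<dots> = (\<Sum>m\<le>n. \<Sum>bs\<in>few_flaw_lists k t m. n choose (n - m))"
    by (intro sum.cong refl, subst card_disjoint_shuffles) (auto dest: notin simp: len)
  also have "\<dots> = (\<Sum>m\<le>n. (n choose (n - m)) * card (few_flaw_lists k t m))"
    by (simp add: mult.commute)
  also have "\<dots> = (\<Sum>j\<le>n. (n choose j) * card (few_flaw_lists k t (n - j)))"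
    by (rule sum.reindex_bij_witness[where i = "\<lambda>j. n - j" and j = "\<lambda>m. n - m"]) auto
  finally show ?thesis .
qed

lemma card_few_flaw_lists:
  assumes "t \<le> k + n"
  shows "of_nat (card (few_flaw_lists k t n))
    = alt_sum (\<lambda>m. fact m * exp_tree (of_nat (k + 1)) $ m) (k + n - t) n"
  using assms
proof (induction t arbitrary: n)
  case 0
  have "few_flaw_lists k 0 n = (if n = 0 then {[]} else {})"
    by (auto simp: few_flaw_lists_def)
  \<comment> \<open>Here d = k + n and a = k + 1, so Abel's identity gives 0^n: only the empty list
    counts.\<close>
  then show ?case
    by (subst alt_sum_exp_tree) (auto simp: power_0_left)
next
  case (Suc t)
  let ?q = "\<lambda>m. fact m * exp_tree (of_nat (k + 1)) $ m"
  define d where "d = k + n - Suc t"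
  have d: "d + 1 = k + n - t"
    using Suc.prems by (simp add: d_def)
  let ?f = "\<lambda>j. of_nat (n choose j) * of_nat (card (few_flaw_lists k t (n - j))) :: rat"
  have "of_nat (card (few_flaw_lists k (Suc t) n)) = sum ?f {..n}"
    by (simp add: card_few_flaw_lists_Suc[OF Suc.prems])
  \<comment> \<open>For j > d + 1 the lists of length n - j are too short for t, as k + (n - j) <
    t.\<close>
  also have "\<dots> = sum ?f ({..n} \<inter> {..d+1})"
    using d by (intro sum.mono_neutral_right) (auto simp: few_flaw_lists_eq_empty)
  also have "\<dots> = (\<Sum>j\<in>{..n} \<inter> {..d+1}. of_nat (n choose j) * alt_sum ?q (d + 1 - j) (n - j))"
  proof (intro sum.cong refl)
    fix j assume "j \<in> {..n} \<inter> {..d+1}"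
    then have "t \<le> k + (n - j)" "k + (n - j) - t = d + 1 - j"
      using d Suc.prems by auto
    then show "?f j = of_nat (n choose j) * alt_sum ?q (d + 1 - j) (n - j)"
      using Suc.IH[of "n - j"] by simp
  qed
  also have "\<dots> = (\<Sum>j\<le>d+1. of_nat (n choose j) * alt_sum ?q (d + 1 - j) (n - j))"
    by (intro sum.mono_neutral_left) (auto simp: binomial_eq_0)
  also have "\<dots> = alt_sum ?q d n"
    by (rule alt_sum_rec)
  finally show ?case by (simp add: d_def)
qed

section \<open>Exactly k flaws and the generating function\<close>

lemma few_flaw_lists_mono: "few_flaw_lists k t n \<subseteq> few_flaw_lists (Suc k) t n"
  by (auto simp: few_flaw_lists_def le_Suc_eq)

lemma flaw_count_eq:
  assumes "t \<le> n"
  shows "flaw_count n t (Suc k)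
    = card (few_flaw_lists (Suc k) t n) - card (few_flaw_lists k t n)"
proof -
  have "{as \<in> preference_sets n. (\<forall>a\<in>set as. a \<le> t) \<and> flaws n {} as = Suc k}
      = {as. length as = n \<and> set as \<subseteq> {1..t} \<and> flaws n {} as \<le> Suc k \<and> \<not> flaws n {} as \<le> k}"
    using assms by (auto simp: preference_sets_def)
  also have "\<dots> = few_flaw_lists (Suc k) t n - few_flaw_lists k t n"
  proof (rule set_eqI)
    fix as
    show "as \<in> {as. length as = n \<and> set as \<subseteq> {1..t} \<and> flaws n {} as \<le> Suc k \<and> \<not> flaws n {} as \<le> k}
        \<longleftrightarrow> as \<in> few_flaw_lists (Suc k) t n - few_flaw_lists k t n"
    proof (cases "length as = n \<and> set as \<subseteq> {1..t}")
      case True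
      then show ?thesis
        using flaws_le_iff_few_flaw_lists[of as n t] assms by simp
    next
      case False
      then show ?thesis
        by (auto simp: few_flaw_lists_def)
    qed
  qed
  finally show ?thesis
    by (simp add: flaw_count_def card_Diff_subset few_flaw_lists_mono)
qed

theorem theorem7p1:
  fixes k s :: nat
  assumes "k \<ge> 1"
  shows "flaw_fps k s =
    parking_fps ^ (k + 1) *
      (\<Sum>i=0..k+s. fps_const ((-1) ^ i * of_nat ((k + s + 1 - i) ^ i) / fact i) * fps_X ^ i)
    - parking_fps ^ k *
      (\<Sum>i=0..k+s-1. fps_const ((-1) ^ i * of_nat ((k + s - i) ^ i) / fact i) * fps_X ^ i)"
proof (rule fps_ext)
  fix n
  obtain k' where k: "k = Suc k'"
    using assms by (cases k) auto
  let ?q = "\<lambda>c m. fact m * exp_tree (of_nat c) $ m"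
  let ?rhs = "alt_sum (?q (k + 1)) (k + s) n - alt_sum (?q k) (k + s - 1) n"
  have "flaw_fps k s $ n = ?rhs / fact n"
  proof (cases "s \<le> n")
    case True
    \<comment> \<open>At t = n - s the parameter k + n - t is k + s, and for k' = k - 1 it is k + s
      - 1, independent of n.\<close>
    have "?rhs = of_nat (card (few_flaw_lists k (n - s) n))
        - of_nat (card (few_flaw_lists k' (n - s) n))"
      using True card_few_flaw_lists[of "n - s" k n] card_few_flaw_lists[of "n - s" k' n]
      by (simp add: k)
    also have "\<dots> = of_nat (flaw_count n (n - s) k)"
      by (simp add: k flaw_count_eq of_nat_diff card_mono few_flaw_lists_mono)
    finally have rhs: "?rhs = of_nat (flaw_count n (n - s) k)" .
    show ?thesis
    proof (cases "s + k \<le> n")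
      case True
      then show ?thesis by (simp only: rhs) (simp add: flaw_fps_def)
    next
      case False
      \<comment> \<open>Now n - s <= k', so every condition j <= k' + ... holds trivially and both
        sets contain all lists with entries up to n - s.\<close>
      then have "few_flaw_lists k (n - s) n = few_flaw_lists k' (n - s) n"
        by (auto simp: few_flaw_lists_def k)
      then have "flaw_count n (n - s) k = 0"
        by (simp add: k flaw_count_eq)
      then show ?thesis using False by (simp only: rhs) (simp add: flaw_fps_def)
    qed
  next
    case False
    then have "?rhs = 0"
      by (simp add: alt_sum_exp_tree k)
    then show ?thesis
      using False by (simp only: \<open>?rhs = 0\<close>) (simp add: flaw_fps_def)
  qed
  then show "flaw_fps k s $ n = (parking_fps ^ (k + 1) *
      (\<Sum>i=0..k+s. fps_const ((-1) ^ i * of_nat ((k + s + 1 - i) ^ i) / fact i) * fps_X ^ i)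
    - parking_fps ^ k *
      (\<Sum>i=0..k+s-1. fps_const ((-1) ^ i * of_nat ((k + s - i) ^ i) / fact i) * fps_X ^ i)) $ n"
    \<comment> \<open>The second polynomial is the case d = k + s - 1, where d + 1 = k + s because k
      >= 1.\<close>
    using fps_nth_mult_alternating_polynomial[of "exp_tree (of_nat (k + 1))" "k + s" n]
      fps_nth_mult_alternating_polynomial[of "exp_tree (of_nat k)" "k + s - 1" n] assms
    by (simp only: parking_fps_power fps_sub_nth diff_divide_distrib le_add_diff_inverse2 trans_le_add1)
qed

end
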